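(* The class of P-rankable sets is not closed under join; that is, there exist P-rankable sets $A, B\subseteq\Sigma^*$ such that $A\oplus B$ is not P-rankable.
   Context: $\Sigma=\{0,1\}$; strings are ordered in length-lexicographic order, and natural numbers are identified with strings in the standard way. For $A\subseteq\Sigma^*$, $\mathrm{rank}_A(y)=\|\{z\mid z\le y \wedge z\in A\}\|$. A (possibly partial) function $f$ is a ranking function for $A$ if $\mathrm{domain}(f)\supseteq A$ and $f(x)=\mathrm{rank}_A(x)$ for all $x\in A$ (no requirement for $x\notin A$); $A$ is P-rankable if it has a ranking function that is a total polynomial-time computable function. The join is $A\oplus B=\{x0\mid x\in A\}\cup\{x1\mid x\in B\}$. *)

theory Defs
  imports "HOL-Library.List_Lenlexorder" "HOL-Computational_Algebra.Polynomial"
begin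

text \<open>
  A string over the alphabet \<open>{0,1}\<close> is a \<open>bool list\<close>, with \<open>False\<close> for \<open>0\<close> and \<open>True\<close> for \<open>1\<close>.
  The order \<open>\<le>\<close> on \<open>bool list\<close> is the length-lexicographic one from the library, where
  \<open>False < True\<close>.
\<close>

type_synonym bitstring = "bool list"

text \<open>
  The standard identification of strings with natural numbers: the empty string is \<open>0\<close>, the string
  \<open>0\<close> is \<open>1\<close>, the string \<open>1\<close> is \<open>2\<close>, the string \<open>00\<close> is \<open>3\<close>, and so on.
  It is shown to be a bijection below.
\<close>

definition nat_of_string :: "bitstring \<Rightarrow> nat" where
  "nat_of_string x = card {z. z < x}"

lemma finite_strings_le: "finite {z :: bitstring. z \<le> x}"
proof (rule finite_subset)
  show "{z. z \<le> x} \<subseteq> {z. set z \<subseteq> UNIV \<and> length z \<le> length x}"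
    by (auto simp: list_le_def list_less_def lenlex_conv)
  show "finite {z :: bitstring. set z \<subseteq> UNIV \<and> length z \<le> length x}"
    by (rule finite_lists_length_le) simp
qed

lemma finite_strings_less: "finite {z :: bitstring. z < x}"
  by (rule finite_subset[OF _ finite_strings_le[of x]]) auto

lemma nat_of_string_strict_mono: "strict_mono nat_of_string"
proof (rule strict_monoI)
  fix x y :: bitstring
  assume "x < y"
  then have "{z. z < x} \<subset> {z. z < y}"
    by (auto dest: less_trans)
  then show "nat_of_string x < nat_of_string y"
    unfolding nat_of_string_def by (rule psubset_card_mono[OF finite_strings_less])
qed

lemma nat_of_string_Nil: "nat_of_string [] = 0"
  by (simp add: nat_of_string_def list_less_def)

lemma surj_nat_of_string: "surj nat_of_string"
proof -
  have "\<exists>x. nat_of_string x = n" for n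
  proof (induction n)
    case 0
    show ?case using nat_of_string_Nil by blast
  next
    case (Suc n)
    then obtain x where x: "nat_of_string x = n" by blast
    define u where "u = x @ [False]"
    have xu: "x < u"
      by (simp add: u_def list_less_def lenlex_conv)
    define S where "S = {z. x < z \<and> z \<le> u}"
    have fin: "finite S"
      unfolding S_def by (rule finite_subset[OF _ finite_strings_le[of u]]) auto
    have ne: "S \<noteq> {}" using xu by (auto simp: S_def)
    define y where "y = Min S"
    have y: "y \<in> S" unfolding y_def using fin ne by (rule Min_in)
    have ymin: "y \<le> z" if "z \<in> S" for z unfolding y_def using fin that by (rule Min_le)
    have "{z. z < y} = insert x {z. z < x}"
    proof (rule set_eqI)
      fix z
      show "z \<in> {z. z < y} \<longleftrightarrow> z \<in> insert x {z. z < x}"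
        using y ymin[of z] unfolding S_def mem_Collect_eq insert_iff
        by (metis le_less_trans less_imp_le less_trans linorder_neqE not_less)
    qed
    then have "nat_of_string y = Suc n"
      using x finite_strings_less[of x] by (simp add: nat_of_string_def)
    then show ?case by blast
  qed
  then show ?thesis by (metis surjI)
qed

lemma bij_nat_of_string: "bij nat_of_string"
  by (simp add: bij_def surj_nat_of_string strict_mono_imp_inj_on[OF nat_of_string_strict_mono])

text \<open>
  Deterministic Turing machines with one two-way infinite tape. The program is a finite partial
  map from a state and a scanned symbol to a new state, a written symbol and a head move, so only
  finitely many states and symbols are relevant. State \<open>0\<close> is initial; the machine halts where
  the program is undefined.
\<close>

datatype tape_symbol = Blank | Bit bool | Aux nat

datatype head_move = Move_Left | Stay | Move_Right

type_synonym program = "nat \<times> tape_symbol \<rightharpoonup> nat \<times> tape_symbol \<times> head_move"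

type_synonym config = "nat \<times> int \<times> (int \<Rightarrow> tape_symbol)"

fun move_head :: "head_move \<Rightarrow> int \<Rightarrow> int" where
  "move_head Move_Left h = h - 1"
| "move_head Stay h = h"
| "move_head Move_Right h = h + 1"

text \<open>A halted configuration is a fixed point of \<open>step\<close>.\<close>

fun step :: "program \<Rightarrow> config \<Rightarrow> config" where
  "step M (q, h, t) =
    (case M (q, t h) of
       None \<Rightarrow> (q, h, t)
     | Some (q', s, d) \<Rightarrow> (q', move_head d h, t(h := s)))"

fun halted :: "program \<Rightarrow> config \<Rightarrow> bool" where
  "halted M (q, h, t) \<longleftrightarrow> M (q, t h) = None"

definition tape_of :: "bitstring \<Rightarrow> int \<Rightarrow> tape_symbol" where
  "tape_of x i = (if 0 \<le> i \<and> i < int (length x) then Bit (x ! nat i) else Blank)"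

definition initial_config :: "bitstring \<Rightarrow> config" where
  "initial_config x = (0, 0, tape_of x)"

text \<open>
  Within \<open>n\<close> steps on input \<open>x\<close> the machine halts, with nothing but \<open>y\<close> on its tape. The final
  state and head position are arbitrary.
\<close>

definition outputs_within :: "program \<Rightarrow> bitstring \<Rightarrow> nat \<Rightarrow> bitstring \<Rightarrow> bool" where
  "outputs_within M x n y \<longleftrightarrow>
    (\<exists>q h. (step M ^^ n) (initial_config x) = (q, h, tape_of y) \<and> halted M (q, h, tape_of y))"

definition poly_time_computable :: "(bitstring \<Rightarrow> bitstring) \<Rightarrow> bool" where
  "poly_time_computable f \<longleftrightarrow>
    (\<exists>M (p :: nat poly). finite (dom M) \<and>
      (\<forall>x. outputs_within M x (poly p (length x)) (f x)))"

definition rank :: "bitstring set \<Rightarrow> bitstring \<Rightarrow> nat" where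
  "rank A y = card {z. z \<le> y \<and> z \<in> A}"

definition ranking_function :: "(bitstring \<rightharpoonup> nat) \<Rightarrow> bitstring set \<Rightarrow> bool" where
  "ranking_function f A \<longleftrightarrow> A \<subseteq> dom f \<and> (\<forall>x\<in>A. f x = Some (rank A x))"

text \<open>The Turing machine outputs the string identified with the value of the ranking function.\<close>

definition P_rankable :: "bitstring set \<Rightarrow> bool" where
  "P_rankable A \<longleftrightarrow>
    (\<exists>g. poly_time_computable g \<and> ranking_function (\<lambda>x. Some (nat_of_string (g x))) A)"

definition join :: "bitstring set \<Rightarrow> bitstring set \<Rightarrow> bitstring set" where
  "join A B = {x @ [False] | x. x \<in> A} \<union> {x @ [True] | x. x \<in> B}"

end

theory Submission
  imports Defs "HOL-Library.Countable_Set"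
begin

text \<open>
  Let \<open>A\<close> consist of all nonempty strings and, for a set \<open>S\<close> of strings, let \<open>B\<close> contain exactly one
  of \<open>u0\<close> and \<open>u1\<close> for every nonempty \<open>u\<close>, namely \<open>u1\<close> if \<open>u \<in> S\<close> and \<open>u0\<close> otherwise. The identity
  ranks \<open>A\<close>, and deleting the last bit ranks \<open>B\<close>, since membership need not be decided. The only
  string strictly between \<open>u00\<close> and \<open>u10\<close> is \<open>u01\<close>, so the ranks of these two elements of the join
  differ by 1 if \<open>u \<in> S\<close> and by 2 otherwise. A ranking function of the join therefore determines \<open>S\<close>,
  and since only countably many functions are computable, some \<open>S\<close> escapes all of them.
\<close>

section \<open>Countability of the polynomial-time computable functions\<close>

instance tape_symbol :: countable
  by countable_datatype

instance head_move :: countable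
  by countable_datatype

text \<open>A program is determined by its graph, here a finite subset of a countable type.\<close>

lemma countable_finite_programs: "countable {M :: program. finite (dom M)}"
proof (rule countable_image_inj_on)
  have "Map.graph ` {M :: program. finite (dom M)} \<subseteq> {G. finite G}"
    by auto
  then show "countable (Map.graph ` {M :: program. finite (dom M)})"
    using countable_Collect_finite countable_subset by blast
  show "inj_on Map.graph {M :: program. finite (dom M)}"
  proof (rule inj_onI, rule ext)
    fix M N :: program and k
    assume "Map.graph M = Map.graph N"
    then have "M k = Some v \<longleftrightarrow> N k = Some v" for v
      by (metis in_graphD in_graphI)
    then show "M k = N k"
      by (metis not_Some_eq)
  qed
qed

lemma step_halted: "halted M c \<Longrightarrow> step M c = c"
  by (cases c) auto

lemma step_funpow_halted: "halted M c \<Longrightarrow> (step M ^^ n) c = c"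
  by (induction n) (auto simp: step_halted)

lemma tape_of_inject: "tape_of x = tape_of y \<longleftrightarrow> x = y"
proof
  assume eq: "tape_of x = tape_of y"
  \<comment> \<open>Cell \<open>length w\<close> is blank on the tape of \<open>w\<close>, hence
    also on that of \<open>v\<close>.\<close>
  have le: "length v \<le> length w" if "tape_of v = tape_of w" for v w
    using fun_cong[OF that, of "int (length w)"] by (auto simp: tape_of_def split: if_splits)
  show "x = y"
  proof (rule nth_equalityI)
    show len: "length x = length y"
      using le[OF eq] le[OF eq[symmetric]] by simp
    show "x ! i = y ! i" if "i < length x" for i
      using fun_cong[OF eq, of "int i"] that len by (simp add: tape_of_def)
  qed
qed simp

text \<open>A halted configuration is a fixed point of \<open>step\<close>, so the longer run ends
  where the shorter one did. This lets a machine alone determine the function it computes, which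
  makes the description \<open>?F\<close> below well defined.\<close>

lemma outputs_within_unique:
  assumes "outputs_within M x m y" "outputs_within M x n z"
  shows "y = z"
proof -
  have *: "y = z" if "outputs_within M x m y" "outputs_within M x n z" "m \<le> n" for m n y z
  proof -
    obtain q h where y: "(step M ^^ m) (initial_config x) = (q, h, tape_of y)"
      "halted M (q, h, tape_of y)"
      using \<open>outputs_within M x m y\<close> by (auto simp: outputs_within_def)
    have "(step M ^^ n) (initial_config x) = (step M ^^ (n - m)) ((step M ^^ m) (initial_config x))"
      using \<open>m \<le> n\<close> by (simp flip: funpow_add comp_apply[of "step M ^^ (n - m)"])
    also have "\<dots> = (q, h, tape_of y)"
      using y step_funpow_halted by metis
    finally show ?thesis
      using \<open>outputs_within M x n z\<close> by (auto simp: outputs_within_def tape_of_inject)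
  qed
  then show ?thesis
    using assms nat_le_linear[of m n] by metis
qed

lemma countable_poly_time_computable: "countable {g. poly_time_computable g}"
proof (rule countable_subset)
  let ?F = "\<lambda>M x. THE y. \<exists>n. outputs_within M x n y"
  show "{g. poly_time_computable g} \<subseteq> ?F ` {M. finite (dom M)}"
  proof
    fix g
    assume "g \<in> {g. poly_time_computable g}"
    then obtain M n where "finite (dom M)" and g: "\<And>x. outputs_within M x (n x) (g x)"
      unfolding poly_time_computable_def by fast
    moreover have "?F M x = g x" for x
      using g[of x] by (blast intro: the_equality outputs_within_unique)
    ultimately show "g \<in> ?F ` {M. finite (dom M)}"
      by (intro image_eqI[of _ _ M]) auto
  qed
  show "countable (?F ` {M. finite (dom M)})"
    by (intro countable_image countable_finite_programs)
qed

section \<open>Machines for the two ranking functions\<close>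

lemma poly_time_computable_id: "poly_time_computable (\<lambda>x. x)"
proof -
  \<comment> \<open>The empty program has halted before its first step.\<close>
  have "outputs_within Map.empty x (poly 0 (length x)) x" for x
    by (simp add: outputs_within_def initial_config_def)
  then show ?thesis
    unfolding poly_time_computable_def by (metis dom_empty finite.emptyI)
qed

text \<open>
  State \<open>0\<close> scans to the first blank, state \<open>1\<close> erases the last bit. On the empty input state \<open>1\<close>
  reads a blank and halts.
\<close>

definition butlast_program :: program where
  "butlast_program = [(0, Bit False) \<mapsto> (0, Bit False, Move_Right),
    (0, Bit True) \<mapsto> (0, Bit True, Move_Right), (0, Blank) \<mapsto> (1, Blank, Move_Left),
    (1, Bit False) \<mapsto> (2, Blank, Stay), (1, Bit True) \<mapsto> (2, Blank, Stay)]"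

lemma butlast_program_Bit:
  "butlast_program (0, Bit b) = Some (0, Bit b, Move_Right)"
  "butlast_program (Suc 0, Bit b) = Some (2, Blank, Stay)"
  by (cases b; simp add: butlast_program_def)+

lemma butlast_program_Blank:
  "butlast_program (0, Blank) = Some (1, Blank, Move_Left)"
  "butlast_program (Suc 0, Blank) = None"
  by (simp_all add: butlast_program_def)

lemma butlast_program_scan:
  "i \<le> length x \<Longrightarrow> (step butlast_program ^^ i) (initial_config x) = (0, int i, tape_of x)"
proof (induction i)
  case (Suc i)
  moreover from Suc have "tape_of x (int i) = Bit (x ! i)"
    by (simp add: tape_of_def)
  ultimately show ?case
    by (auto simp: butlast_program_Bit fun_upd_idem)
qed (simp add: initial_config_def)

lemma tape_of_butlast:
  "x \<noteq> [] \<Longrightarrow> (tape_of x)(int (length x) - 1 := Blank) = tape_of (butlast x)"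
  by (rule ext) (auto simp: tape_of_def nth_butlast)

text \<open>One step passes over each bit, one turns back at the blank and one erases. On the empty
  input the last of these is idle.\<close>

lemma outputs_within_butlast:
  "outputs_within butlast_program x (length x + 2) (butlast x)"
proof (cases "x = []")
  case True
  have "tape_of [] i = Blank" for i
    by (simp add: tape_of_def)
  with True show ?thesis
    by (simp add: outputs_within_def initial_config_def butlast_program_Blank fun_upd_idem)
next
  case False
  then have "tape_of x (int (length x) - 1) = Bit (last x)"
    by (simp add: tape_of_def last_conv_nth nat_diff_distrib Suc_le_eq)
  moreover have "tape_of x (int (length x)) = Blank"
    by (simp add: tape_of_def)
  ultimately have "(step butlast_program ^^ (length x + 2)) (initial_config x) =
      (2, int (length x) - 1, tape_of (butlast x))"
    using False by (simp add: butlast_program_scan butlast_program_Bit butlast_program_Blank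
        fun_upd_idem tape_of_butlast)
  then show ?thesis
    by (simp add: outputs_within_def butlast_program_def)
qed

lemma poly_time_computable_butlast: "poly_time_computable butlast"
proof -
  have "outputs_within butlast_program x (poly [:2, 1:] (length x)) (butlast x)" for x
    using outputs_within_butlast[of x] by (simp add: add.commute)
  moreover have "finite (dom butlast_program)"
    by (simp add: butlast_program_def)
  ultimately show ?thesis
    unfolding poly_time_computable_def by blast
qed

section \<open>Length-lexicographic order and ranks\<close>

lemma Nil_le_string: "[] \<le> (x :: bitstring)"
  by (cases x) (simp_all add: le_less list_less_def)

lemma snoc_lex_iff:
  "length u = length v \<Longrightarrow> (u @ [a], v @ [b]) \<in> lex r \<longleftrightarrow> (u, v) \<in> lex r \<or> u = v \<and> (a, b) \<in> r"
  by (induction u v rule: list_induct2) auto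

lemma snoc_less_iff:
  fixes u v :: bitstring
  shows "u @ [a] < v @ [b] \<longleftrightarrow> u < v \<or> u = v \<and> a < b"
  by (auto simp: list_less_def lenlex_conv snoc_lex_iff)

text \<open>Removing the least element \<open>[]\<close> from the strings up to \<open>x\<close>
  leaves as many as removing the greatest, \<open>x\<close> itself.\<close>

lemma card_nonempty_le: "card {z. z \<le> x \<and> z \<noteq> []} = nat_of_string x"
proof -
  have "insert [] {z. z \<le> x \<and> z \<noteq> []} = insert x {z. z < x}"
    using Nil_le_string[of x] by (auto simp: le_less)
  then have "card (insert [] {z. z \<le> x \<and> z \<noteq> []}) = card (insert x {z. z < x})"
    by simp
  moreover have "finite {z. z \<le> x \<and> z \<noteq> []}"
    using finite_strings_le[of x] by (rule rev_finite_subset) auto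
  ultimately show ?thesis
    using finite_strings_less[of x] by (simp add: nat_of_string_def)
qed

text \<open>The truth value \<open>u \<in> S\<close> itself is the appended bit. Leaving out
  \<open>u = []\<close> makes the rank of an element exactly the number of its prefix, rather than
  one more.\<close>

definition selector :: "bitstring set \<Rightarrow> bitstring set" where
  "selector S = {u @ [u \<in> S] | u. u \<noteq> []}"

lemma P_rankable_nonempty: "P_rankable {x. x \<noteq> []}"
  unfolding P_rankable_def ranking_function_def
  using poly_time_computable_id by (auto simp: rank_def card_nonempty_le)

lemma P_rankable_selector: "P_rankable (selector S)"
proof -
  have "rank (selector S) (u @ [u \<in> S]) = nat_of_string u" for u
  proof -
    \<comment> \<open>The prefix determines the last bit, so elements of the selector compare as
      their prefixes do.\<close>
    have "{z. z \<le> u @ [u \<in> S] \<and> z \<in> selector S} = (\<lambda>v. v @ [v \<in> S]) ` {v. v \<le> u \<and> v \<noteq> []}"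
      by (auto simp: selector_def le_less snoc_less_iff)
    moreover have "inj_on (\<lambda>v. v @ [v \<in> S]) {v. v \<le> u \<and> v \<noteq> []}"
      by (auto intro: inj_onI)
    ultimately show ?thesis
      by (simp add: rank_def card_image card_nonempty_le)
  qed
  then have "ranking_function (\<lambda>x. Some (nat_of_string (butlast x))) (selector S)"
    by (auto simp: ranking_function_def selector_def)
  then show ?thesis
    unfolding P_rankable_def using poly_time_computable_butlast by blast
qed

lemma rank_join_selector:
  assumes "u \<noteq> []"
  shows "rank (join {x. x \<noteq> []} (selector S)) (u @ [True, False]) =
    Suc (rank (join {x. x \<noteq> []} (selector S)) (u @ [False, False])) \<longleftrightarrow> u \<in> S"
proof -
  let ?J = "join {x. x \<noteq> []} (selector S)"
  let ?L = "{z. z \<le> u @ [False, False] \<and> z \<in> ?J}"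
  have less: "u @ [False, False] < u @ [False, True]" "u @ [False, True] < u @ [True, False]"
    "u @ [False, False] < u @ [True, False]"
    using snoc_less_iff[of "u @ [_]" _ "u @ [_]"] snoc_less_iff[of u _ u] by simp_all
  \<comment> \<open>Strings of length at most 1 lie below both bounds because \<open>u\<close> is
    nonempty; for the others, peeling off the last two bits reduces the comparison to
    prefixes.\<close>
  have between: "z \<le> u @ [True, False] \<longleftrightarrow>
      z \<le> u @ [False, False] \<or> z = u @ [False, True] \<or> z = u @ [True, False]" for z
  proof (cases z rule: rev_cases)
    case Nil
    then show ?thesis by (simp add: Nil_le_string)
  next
    case (snoc y b)
    show ?thesis
    proof (cases y rule: rev_cases)
      case Nil
      then have "length z < length (u @ [c, d])" for c d
        using assms snoc by (cases u) auto
      then have "z \<le> u @ [c, d]" for c d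
        by (simp add: list_le_def list_less_def lenlex_conv)
      then show ?thesis by blast
    next
      case (snoc w a)
      then show ?thesis
        using \<open>z = y @ [b]\<close> snoc_less_iff[of "w @ [a]" b "u @ [_]" False] snoc_less_iff[of w a u]
        by (auto simp: le_less)
    qed
  qed
  \<comment> \<open>The final bit names the side of the join: \<open>False\<close> asks only for a
    nonempty prefix, \<open>True\<close> asks whether \<open>u @ [False]\<close> is in the
    selector.\<close>
  have mem: "u @ [True, False] \<in> ?J" "u @ [False, True] \<in> ?J \<longleftrightarrow> u \<notin> S"
    using assms by (auto simp: join_def selector_def append_eq_append_conv2 append_eq_Cons_conv
      Cons_eq_append_conv)
  have "finite ?L"
    using finite_strings_le[of "u @ [False, False]"] by (rule rev_finite_subset) auto
  moreover have "u @ [False, True] \<notin> ?L" "u @ [True, False] \<notin> ?L"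
    using less by (auto simp: leD)
  moreover have "{z. z \<le> u @ [True, False] \<and> z \<in> ?J} =
      insert (u @ [True, False]) (if u \<in> S then ?L else insert (u @ [False, True]) ?L)"
    using mem by (auto simp: between)
  ultimately show ?thesis
    by (simp add: rank_def)
qed

section \<open>Diagonalisation\<close>

theorem theorem27:
  shows "\<exists>A B :: bitstring set. P_rankable A \<and> P_rankable B \<and> \<not> P_rankable (join A B)"
proof -
  \<comment> \<open>The identity witnesses that the countable set is nonempty, so a sequence can
    enumerate it.\<close>
  obtain g :: "nat \<Rightarrow> bitstring \<Rightarrow> bitstring" where g: "{f. poly_time_computable f} \<subseteq> range g"
    using countable_poly_time_computable poly_time_computable_id
    by (metis empty_iff mem_Collect_eq order_refl range_from_nat_into)
  \<comment> \<open>Strings of length \<open>n + 1\<close> diagonalise against \<open>g n\<close>; the empty string carries no choice.\<close>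
  define S where "S = {u. nat_of_string (g (length u - 1) (u @ [True, False])) \<noteq>
    Suc (nat_of_string (g (length u - 1) (u @ [False, False])))}"
  let ?J = "join {x. x \<noteq> []} (selector S)"
  have "\<not> P_rankable ?J"
  proof
    assume "P_rankable ?J"
    then obtain n where n: "ranking_function (\<lambda>x. Some (nat_of_string (g n x))) ?J"
      unfolding P_rankable_def using g by blast
    \<comment> \<open>Any string of length \<open>Suc n\<close> would do: then
      \<open>length u - 1\<close> is \<open>n\<close>, so \<open>g n\<close> decides whether
      \<open>u\<close> lies in \<open>S\<close>, in the sense opposite to
      \<open>rank_join_selector\<close>.\<close>
    define u where "u = replicate (Suc n) False"
    have mem: "u @ [b, False] \<in> ?J" for b
      by (auto simp: join_def)
    have "nat_of_string (g n (u @ [b, False])) = rank ?J (u @ [b, False])" for b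
      using n mem[of b] by (simp add: ranking_function_def)
    then have "u \<in> S \<longleftrightarrow> rank ?J (u @ [True, False]) \<noteq> Suc (rank ?J (u @ [False, False]))"
      by (simp add: S_def u_def)
    then show False
      using rank_join_selector[of u S] by (simp add: u_def)
  qed
  then show ?thesis
    using P_rankable_nonempty P_rankable_selector by blast
qed

end
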